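(* Let $G$ be a finite group, and let $C(G)$ denote the set of cyclic subgroups of $G$. Then $|C(G)| = |G| - 1$ if and only if $G$ is isomorphic to one of the following groups: $\mathbb{Z}_3$, $\mathbb{Z}_4$, $S_3$ or $D_8$.
   Context: For a finite group $G$, $C(G)$ is the poset (set) of all cyclic subgroups of $G$, including the trivial subgroup. $\mathbb{Z}_n$ denotes the cyclic group of order $n$, $S_3$ the symmetric group on three letters, and $D_8$ the dihedral group of order $8$. *)

theory Defs
  imports
    "HOL-Algebra.Elementary_Groups"
    "HOL-Algebra.Sym_Groups"
begin

definition cyclic_subgroups :: "('a, 'b) monoid_scheme \<Rightarrow> 'a set set"
  where "cyclic_subgroups G = {H. subgroup H G \<and> cyclic_group (G\<lparr>carrier := H\<rparr>)}"

(* The semidirect product of Z_n by a group of order 2 acting by inversion. The pair (i, s) stands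
   for r^i if s is False and for r^i f if s is True, where r is a rotation with r^n = 1, f is a
   reflection and f r f = r^(-1). The parameter n is the number of rotations, so for n > 0 the
   order is 2 n; n = 0 gives the infinite dihedral group. *)
definition dihedral_group :: "nat \<Rightarrow> (int \<times> bool) monoid"
  where "dihedral_group n =
    \<lparr>carrier = carrier (integer_mod_group n) \<times> UNIV,
     monoid.mult = (\<lambda>(i, s) (j, t). ((if s then i - j else i + j) mod int n, s \<noteq> t)),
     one = (0, False)\<rparr>"

lemma group_dihedral_group: "group (dihedral_group n)"
proof (rule groupI)
  fix x assume "x \<in> carrier (dihedral_group n)"
  then obtain i s where x: "x = (i, s)" and i: "i \<in> carrier (integer_mod_group n)"
    by (auto simp: dihedral_group_def)
  have "(if s then (i, True) else ((- i) mod int n, False)) \<in> carrier (dihedral_group n)"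
    using i by (auto simp: dihedral_group_def carrier_integer_mod_group)
  moreover have "(if s then (i, True) else ((- i) mod int n, False)) \<otimes>\<^bsub>dihedral_group n\<^esub> x
      = \<one>\<^bsub>dihedral_group n\<^esub>"
    by (auto simp: dihedral_group_def x mod_simps)
  ultimately show "\<exists>y\<in>carrier (dihedral_group n). y \<otimes>\<^bsub>dihedral_group n\<^esub> x = \<one>\<^bsub>dihedral_group n\<^esub>"
    by blast
qed (auto simp: dihedral_group_def carrier_integer_mod_group mod_simps algebra_simps
     split: if_splits)

lemma order_dihedral_group: "n > 0 \<Longrightarrow> order (dihedral_group n) = 2 * n"
  by (simp add: order_def dihedral_group_def carrier_integer_mod_group card_cartesian_product)

end

theory Submission
  imports Defs "HOL-Algebra.Multiplicative_Group"
begin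

text \<open>Two distinct generators of the same cyclic subgroup have order at least 3, and such an element
  always shares its subgroup with its inverse. So the map from \<open>x\<close> to the subgroup it generates
  takes one value fewer than there are elements iff exactly one pair \<open>{g, g\<inverse>}\<close> fails \<open>x\<^sup>2 = 1\<close>. Then \<open>g\<^sup>2\<close> is \<open>g\<inverse>\<close> or squares
  to 1, so \<open>g\<close> has order 3 or 4. For \<open>x\<close> outside \<open>\<langle>g\<rangle>\<close> both \<open>x\<close> and \<open>x g\<close> are involutions, so \<open>x\<close>
  inverts \<open>g\<close>. A product of two such elements centralises \<open>g\<close>, hence lies in \<open>\<langle>g\<rangle>\<close>. So \<open>\<langle>g\<rangle>\<close> has
  index at most 2, and the group is cyclic or dihedral.\<close>

section \<open>Counting cyclic subgroups by their generators\<close>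

definition non_involutions :: "('a, 'b) monoid_scheme \<Rightarrow> 'a set"
  where "non_involutions G = {x \<in> carrier G. x \<otimes>\<^bsub>G\<^esub> x \<noteq> \<one>\<^bsub>G\<^esub>}"

context group
begin

lemma cyclic_subgroups_eq: "cyclic_subgroups G = (\<lambda>x. generate G {x}) ` carrier G"
proof -
  have gen: "generate G {x} = range (\<lambda>n::int. x [^] n)" if "x \<in> carrier G" for x
    using generate_pow[OF that] by auto
  have "cyclic_group (G\<lparr>carrier := H\<rparr>) \<longleftrightarrow> (\<exists>x\<in>H. H = generate G {x})"
    if H: "subgroup H G" for H
  proof -
    interpret H: group "G\<lparr>carrier := H\<rparr>"
      using H subgroup_imp_group by blast
    have "x [^]\<^bsub>G\<lparr>carrier := H\<rparr>\<^esub> n = x [^] n" if "x \<in> H" for x and n :: int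
      using int_pow_consistent[OF H that] by simp
    with gen H subgroup.mem_carrier[OF H] show ?thesis
      by (auto simp: H.cyclic_group)
  qed
  moreover have "subgroup (generate G {x}) G" "x \<in> generate G {x}" if "x \<in> carrier G" for x
    using that by (auto intro: generate_is_subgroup generate.incl)
  moreover have "x \<in> carrier G" if "subgroup H G" "x \<in> H" for x H
    using that by (rule subgroup.mem_carrier)
  ultimately show ?thesis
    unfolding cyclic_subgroups_def by blast
qed

lemma generate_inv:
  assumes "x \<in> carrier G"
  shows "generate G {inv x} = generate G {x}"
proof -
  have "generate G {inv y} \<subseteq> generate G {y}" if "y \<in> carrier G" for y
    using that by (intro generate_subgroup_incl generate_is_subgroup) (auto intro: generate.inv)
  from this[of x] this[of "inv x"] show ?thesis
    using assms by auto
qed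

lemma cyclic_subgroups_eq_Diff:
  assumes "g \<in> carrier G" "inv g \<noteq> g"
  shows "cyclic_subgroups G = (\<lambda>x. generate G {x}) ` (carrier G - {inv g})"
proof -
  have "generate G {inv g} \<in> (\<lambda>x. generate G {x}) ` (carrier G - {inv g})"
    using assms by (intro image_eqI[where x = g]) (auto simp: generate_inv)
  then show ?thesis
    unfolding cyclic_subgroups_eq by blast
qed

lemma non_involutions_iff: "x \<in> non_involutions G \<longleftrightarrow> x \<in> carrier G \<and> inv x \<noteq> x"
  by (auto simp: non_involutions_def) (metis inv_equality r_inv)+

lemma inv_non_involutions: "x \<in> non_involutions G \<Longrightarrow> inv x \<in> non_involutions G"
  by (auto simp: non_involutions_iff)

text \<open>Elements of order at most 2 can be read off from the subgroups they generate, so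
  collisions can only come from \<open>non_involutions G\<close>.\<close>

lemma generate_involution:
  assumes "x \<in> carrier G" "x \<notin> non_involutions G"
  shows "generate G {x} = {\<one>, x}"
proof
  have "subgroup {\<one>, x} G"
    using assms by (auto simp: non_involutions_def intro!: subgroupI) (metis inv_equality)+
  then show "generate G {x} \<subseteq> {\<one>, x}"
    by (intro generate_subgroup_incl) auto
qed (auto intro: generate.incl generate.one)

lemma card_cyclic_subgroups_iff:
  assumes fin: "finite (carrier G)"
  shows "card (cyclic_subgroups G) = order G - 1 \<longleftrightarrow>
    (\<exists>g. inv g \<noteq> g \<and> non_involutions G = {g, inv g})"
proof
  let ?f = "\<lambda>x. generate G {x}"
  assume card: "card (cyclic_subgroups G) = order G - 1"
  have "non_involutions G \<noteq> {}"
  proof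
    assume empty: "non_involutions G = {}"
    have "inj_on ?f (carrier G)"
      by (rule inj_onI) (use empty generate_involution in \<open>auto simp: doubleton_eq_iff\<close>)
    then have "card (cyclic_subgroups G) = order G"
      by (simp add: cyclic_subgroups_eq card_image order_def)
    \<comment> \<open>Positivity of the order matters: truncated subtraction would allow
      \<open>order G = order G - 1\<close> at 0.\<close>
    with card show False
      using fin order_gt_0_iff_finite by simp
  qed
  then obtain g where g: "g \<in> non_involutions G"
    by blast
  then have gc: "g \<in> carrier G" "inv g \<noteq> g"
    by (auto simp: non_involutions_iff)
  let ?A = "carrier G - {inv g}"
  have "cyclic_subgroups G = ?f ` ?A"
    using cyclic_subgroups_eq_Diff gc by blast
  \<comment> \<open>The domain and the image both have \<open>order G - 1\<close> elements, which
    forces injectivity.\<close>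
  then have inj: "inj_on ?f ?A"
    using card fin gc by (intro eq_card_imp_inj_on) (auto simp: order_def)
  \<comment> \<open>A further non-involution \<open>x\<close> would lie in \<open>?A\<close>
    together with \<open>inv x\<close>, and these two would collide.\<close>
  have "x \<in> {g, inv g}" if "x \<in> non_involutions G" for x
  proof (rule ccontr)
    assume "x \<notin> {g, inv g}"
    moreover have "x \<in> carrier G" "inv x \<noteq> x"
      using that by (auto simp: non_involutions_iff)
    ultimately show False
      using inj_onD[OF inj generate_inv[of x]] gc by (metis Diff_iff inv_closed inv_inv insertCI singletonD)
  qed
  with g inv_non_involutions[OF g] gc show "\<exists>g. inv g \<noteq> g \<and> non_involutions G = {g, inv g}"
    by blast
next
  let ?f = "\<lambda>x. generate G {x}"
  assume "\<exists>g. inv g \<noteq> g \<and> non_involutions G = {g, inv g}"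
  then obtain g where g: "inv g \<noteq> g" "non_involutions G = {g, inv g}"
    by blast
  then have gc: "g \<in> carrier G"
    using non_involutions_iff by blast
  let ?A = "carrier G - {inv g}"
  have img: "cyclic_subgroups G = ?f ` ?A"
    using cyclic_subgroups_eq_Diff gc g(1) by blast
  have sub: "generate G {x} = {\<one>, x}" if "x \<in> ?A" "x \<noteq> g" for x
    using generate_involution that g by auto
  have g_in: "g \<in> generate G {g}" "inv g \<in> generate G {g}" "\<one> \<in> generate G {g}"
    by (auto intro: generate.intros)
  \<comment> \<open>The element \<open>g\<close> separates the two subgroups: it is neither
    \<open>\<one>\<close> nor \<open>x\<close>.\<close>
  have neq: "generate G {x} \<noteq> generate G {g}" if "x \<in> ?A" "x \<noteq> g" for x
  proof -
    have "g \<noteq> \<one>" using g by auto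
    then show ?thesis
      using sub[OF that] g_in that by auto
  qed
  have "inj_on ?f ?A"
  proof (rule inj_onI)
    fix x y assume "x \<in> ?A" "y \<in> ?A" "?f x = ?f y"
    then show "x = y"
      using sub[of x] sub[of y] neq[of x] neq[of y] by (cases "x = g"; cases "y = g") (auto simp: doubleton_eq_iff)
  qed
  then show "card (cyclic_subgroups G) = order G - 1"
    using img gc by (simp add: card_image order_def)
qed

section \<open>Recognising cyclic and dihedral groups from generators and relations\<close>

lemma iso_integer_mod_groupI:
  assumes fin: "finite (carrier G)" and g: "g \<in> carrier G"
    and gen: "carrier G = range (\<lambda>i::int. g [^] i)"
  shows "G \<cong> integer_mod_group (ord g)"
proof -
  let ?n = "ord g" and ?h = "\<lambda>i::int. g [^] i"
  have n: "?n > 0"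
    using ord_ge_1[OF fin g] by simp
  \<comment> \<open>Exponents count only modulo the order of \<open>g\<close>, so the reduction in
    the model group is invisible in \<open>G\<close>.\<close>
  have pow: "g [^] (i mod int ?n) = g [^] i" for i :: int
    using g by (simp add: int_pow_eq dvd_minus_mod)
  have "?h \<in> hom (integer_mod_group ?n) G"
    using g by (intro homI) (auto simp: pow int_pow_mult)
  moreover have "bij_betw ?h (carrier (integer_mod_group ?n)) (carrier G)"
    unfolding bij_betw_def
  proof
    show "inj_on ?h (carrier (integer_mod_group ?n))"
      using n g by (auto intro!: inj_onI simp: carrier_integer_mod_group int_pow_eq
          simp flip: mod_eq_dvd_iff)
    have "g [^] i \<in> ?h ` carrier (integer_mod_group ?n)" for i :: int
      using n by (intro image_eqI[where x = "i mod int ?n"]) (auto simp: pow carrier_integer_mod_group)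
    then show "?h ` carrier (integer_mod_group ?n) = carrier G"
      using g by (auto simp: gen)
  qed
  ultimately have "integer_mod_group ?n \<cong> G"
    by (auto simp: is_iso_def iso_def)
  then show ?thesis
    by (simp add: group.iso_sym)
qed

text \<open>The map sends \<open>(i, s)\<close> to \<open>g [^] i\<close>, followed by
  \<open>t\<close> if \<open>s\<close> holds. The relations make it a homomorphism, \<open>t\<close>
  not being a power of \<open>g\<close> makes it injective, and the bound on the order then makes it
  surjective.\<close>

lemma iso_dihedral_groupI:
  assumes fin: "finite (carrier G)" and g: "g \<in> carrier G" and t: "t \<in> carrier G"
    and ordG: "order G \<le> 2 * ord g"
    and t_notin: "\<And>i::int. t \<noteq> g [^] i"
    and tt: "t \<otimes> t = \<one>" and conj: "t \<otimes> g \<otimes> t = inv g"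
  shows "G \<cong> dihedral_group (ord g)"
proof -
  let ?n = "ord g"
  define h where "h = (\<lambda>(i::int, s). g [^] i \<otimes> (if s then t else \<one>))"
  have n: "?n > 0"
    using ord_ge_1[OF fin g] by simp
  have pow: "g [^] (i mod int ?n) = g [^] i" for i :: int
    using g by (simp add: int_pow_eq dvd_minus_mod)
  have swap_nat: "t \<otimes> g [^] k = inv (g [^] k) \<otimes> t" for k :: nat
  proof (induction k)
    case (Suc k)
    have tg: "t \<otimes> g = inv g \<otimes> t"
      using conj g t tt by (metis inv_closed m_assoc m_closed r_one)
    have "t \<otimes> g [^] Suc k = inv (g [^] k) \<otimes> (t \<otimes> g)"
      using Suc g t by (simp flip: m_assoc)
    also have "\<dots> = inv (g [^] k) \<otimes> inv g \<otimes> t"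
      using g t by (simp add: tg m_assoc)
    also have "inv (g [^] k) \<otimes> inv g = inv (g [^] Suc k)"
      using g by (metis inv_mult_group nat_pow_Suc2 nat_pow_closed nat_pow_Suc)
    finally show ?case .
  qed (use t in simp)
  have swap: "t \<otimes> g [^] i = g [^] (- i) \<otimes> t" for i :: int
  proof (cases i)
    case (nonneg k)
    then show ?thesis
      using swap_nat[of k] g by (simp add: int_pow_neg int_pow_int)
  next
    case (neg k)
    \<comment> \<open>Here \<open>i\<close> is \<open>- int (Suc k)\<close>, so
      \<open>g [^] i\<close> is \<open>inv a\<close>. The relation for the natural power
      \<open>a\<close> gives \<open>a t a = t\<close>, which is solved for
      \<open>t \<otimes> inv a\<close>.\<close>
    define a where "a = g [^] Suc k"
    have a: "a \<in> carrier G" "t \<otimes> a = inv a \<otimes> t"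
      unfolding a_def using g swap_nat by blast+
    then have "a \<otimes> (t \<otimes> a) = t"
      using t by (simp flip: m_assoc)
    then have "a \<otimes> t = t \<otimes> inv a"
      using a(1) t by (metis inv_solve_right m_assoc m_closed)
    moreover have "g [^] i = inv a" "g [^] (- i) = a"
      using g by (simp_all add: neg a_def int_pow_neg_int del: of_nat_Suc nat_pow_Suc flip: int_pow_int)
    ultimately show ?thesis by simp
  qed
  have "h \<in> hom (dihedral_group ?n) G"
  proof (rule homI)
    fix x y
    assume "x \<in> carrier (dihedral_group ?n)" "y \<in> carrier (dihedral_group ?n)"
    obtain i s j u where xy: "x = (i, s)" "y = (j, u)"
      by (metis surj_pair)
    \<comment> \<open>\<open>flip\<close> and \<open>rot\<close> are the cases of a reflection or a
      rotation as left factor; \<open>v\<close> stands for the \<open>t\<close> or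
      \<open>\<one>\<close> that ends the right factor.\<close>
    have flip: "g [^] i \<otimes> t \<otimes> (g [^] j \<otimes> v) = g [^] (i - j) \<otimes> (t \<otimes> v)" if "v \<in> carrier G" for v
    proof -
      have "g [^] i \<otimes> t \<otimes> (g [^] j \<otimes> v) = g [^] i \<otimes> (t \<otimes> g [^] j) \<otimes> v"
        using g t that by (simp add: m_assoc)
      also have "\<dots> = g [^] (i + (- j)) \<otimes> (t \<otimes> v)"
        unfolding swap int_pow_mult[OF g] using g t that by (simp add: m_assoc)
      finally show ?thesis by simp
    qed
    have rot: "g [^] i \<otimes> (g [^] j \<otimes> v) = g [^] (i + j) \<otimes> v" if "v \<in> carrier G" for v
      using g that by (simp add: int_pow_mult m_assoc)
    show "h (x \<otimes>\<^bsub>dihedral_group ?n\<^esub> y) = h x \<otimes> h y"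
      using flip[of t] flip[of \<one>] rot[of t] rot[of \<one>] g t tt by (auto simp: xy h_def dihedral_group_def pow)
  qed (use g t in \<open>auto simp: h_def split: prod.splits\<close>)
  moreover have inj: "inj_on h (carrier (dihedral_group ?n))"
  proof (rule inj_onI, clarify)
    fix i s j u
    assume c: "(i, s) \<in> carrier (dihedral_group ?n)" "(j, u) \<in> carrier (dihedral_group ?n)"
      and eq: "h (i, s) = h (j, u)"
    \<comment> \<open>Rotations and reflections have disjoint images, so \<open>h\<close> determines
      the flag; after cancelling \<open>t\<close> it determines the exponent.\<close>
    have no: "g [^] a \<otimes> t \<noteq> g [^] b" for a b :: int
    proof
      assume "g [^] a \<otimes> t = g [^] b"
      then have "t = g [^] (- a) \<otimes> g [^] b"
        using g t by (metis int_pow_closed int_pow_neg inv_solve_left)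
      then show False
        using t_notin g by (metis int_pow_mult)
    qed
    have "s = u"
      using eq no no[symmetric] g t by (auto simp: h_def split: if_splits)
    then have "g [^] i = g [^] j"
      using eq g t by (auto simp: h_def split: if_splits)
    then have "i = j"
      using c n g by (auto simp: dihedral_group_def carrier_integer_mod_group int_pow_eq
          simp flip: mod_eq_dvd_iff)
    with \<open>s = u\<close> show "i = j \<and> s = u" by simp
  qed
  moreover have "h ` carrier (dihedral_group ?n) = carrier G"
  proof (rule card_seteq[OF fin])
    show "h ` carrier (dihedral_group ?n) \<subseteq> carrier G"
      using g t by (auto simp: h_def)
    show "card (carrier G) \<le> card (h ` carrier (dihedral_group ?n))"
      using inj ordG order_dihedral_group[OF n] by (simp add: card_image order_def)
  qed
  ultimately have "dihedral_group ?n \<cong> G"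
    by (auto simp: is_iso_def iso_def bij_betw_def)
  then show ?thesis
    by (simp add: group.iso_sym group_dihedral_group)
qed

section \<open>Groups whose non-involutions form a single inverse pair\<close>

lemma ord_eq_3:
  assumes g: "g \<in> carrier G" "g \<noteq> \<one>" "g \<otimes> g \<otimes> g = \<one>"
  shows "ord g = 3"
proof -
  have "g [^] (3::nat) = \<one>"
    using g by (simp add: numeral_3_eq_3)
  then have "ord g dvd 3"
    using g(1) pow_eq_id by blast
  moreover have "ord g \<noteq> 1"
    using g ord_eq_1 by blast
  moreover have "n = 3" if "n dvd 3" "n \<noteq> 1" for n :: nat
  proof -
    have "n \<le> 3"
      using that(1) by (rule dvd_imp_le) simp
    then have "n = 0 \<or> n = 1 \<or> n = 2 \<or> n = 3"
      by linarith
    then show ?thesis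
      using that by auto
  qed
  ultimately show ?thesis by blast
qed

lemma ord_eq_4:
  assumes g: "g \<in> carrier G" "g \<otimes> g \<noteq> \<one>" "g \<otimes> g \<otimes> (g \<otimes> g) = \<one>"
  shows "ord g = 4"
proof -
  \<comment> \<open>The exponent is split so that the power becomes the product of two squares in
    the hypothesis.\<close>
  have "g [^] (2 + 2 :: nat) = \<one>"
    unfolding nat_pow_mult[OF g(1), symmetric] using g by (simp add: numeral_2_eq_2)
  then have "ord g dvd 4"
    using g(1) pow_eq_id[of g "2 + 2"] by simp
  moreover have "\<not> ord g dvd 2"
    using g pow_eq_id[of g 2] by (simp add: numeral_2_eq_2)
  moreover have "n = 4" if "n dvd 4" "\<not> n dvd 2" for n :: nat
  proof -
    have "n \<le> 4"
      using that(1) by (rule dvd_imp_le) simp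
    then have "n = 0 \<or> n = 1 \<or> n = 2 \<or> n = 3 \<or> n = 4"
      by linarith
    then show ?thesis
      using that by auto
  qed
  ultimately show ?thesis by blast
qed

text \<open>Two possible orders of \<open>g\<close> and two possible indices of the subgroup it
  generates leave four candidates.\<close>

lemma iso_of_non_involutions:
  assumes fin: "finite (carrier G)"
    and g: "inv g \<noteq> g" "non_involutions G = {g, inv g}"
  shows "ord g \<in> {3, 4} \<and> (G \<cong> integer_mod_group (ord g) \<or> G \<cong> dihedral_group (ord g))"
proof
  have gN: "g \<in> non_involutions G"
    using g(2) by blast
  then have gc: "g \<in> carrier G"
    using non_involutions_iff by blast
  have g1: "g \<noteq> \<one>" "g \<otimes> g \<noteq> \<one>"
    using gN by (auto simp: non_involutions_def)
  show "ord g \<in> {3, 4}"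
  \<comment> \<open>If the square is a non-involution, it is \<open>g\<close> or
    \<open>inv g\<close>; the first would give \<open>g = \<one>\<close>, the second gives order 3.
    Otherwise the fourth power is \<open>\<one>\<close>.\<close>
  proof (cases "g \<otimes> g \<in> non_involutions G")
    case True
    then have "g \<otimes> g = inv g"
      using g g1 gc by (metis insertE l_cancel_one singletonD)
    then have "ord g = 3"
      using ord_eq_3 gc g1 by simp
    then show ?thesis by simp
  next
    case False
    then show ?thesis
      using ord_eq_4 gc g1 by (simp add: non_involutions_def)
  qed
  let ?H = "range (\<lambda>i::int. g [^] i)"
  have H: "?H = generate G {g}"
    using generate_pow[OF gc] by auto
  interpret H: subgroup ?H G
    unfolding H using gc by (intro generate_is_subgroup) auto
  have gH: "g \<in> ?H"
    unfolding H by (auto intro: generate.incl)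
  have cardH: "card ?H = ord g"
    unfolding H using gc by (simp add: generate_pow_card)
  \<comment> \<open>Both non-involutions lie in \<open>?H\<close>.\<close>
  have sq: "x \<otimes> x = \<one>" if "x \<in> carrier G" "x \<notin> ?H" for x
    using that g H.m_inv_closed gH by (auto simp: non_involutions_def)
  have conj: "x \<otimes> g \<otimes> x = inv g" if x: "x \<in> carrier G" "x \<notin> ?H" for x
  proof -
    have "x \<otimes> g \<notin> ?H"
    proof
      assume "x \<otimes> g \<in> ?H"
      then have "x \<otimes> g \<otimes> inv g \<in> ?H"
        using gH H.m_closed H.m_inv_closed by blast
      then show False
        using x gc by (simp add: m_assoc)
    qed
    then have "x \<otimes> g \<otimes> x \<otimes> g = \<one>"
      using sq[of "x \<otimes> g"] x gc by (simp add: m_assoc)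
    then show ?thesis
      using x gc by (metis inv_equality m_closed)
  qed
  show "G \<cong> integer_mod_group (ord g) \<or> G \<cong> dihedral_group (ord g)"
  proof (cases "carrier G = ?H")
    case True
    then show ?thesis
      using iso_integer_mod_groupI[OF fin gc] by blast
  next
    case False
    then obtain t where t: "t \<in> carrier G" "t \<notin> ?H"
      using H.subset by blast
    have "x \<in> ?H \<union> (\<lambda>y. y \<otimes> t) ` ?H" if x: "x \<in> carrier G" for x
    proof (cases "x \<in> ?H")
      case False
      \<comment> \<open>Otherwise \<open>x \<otimes> t\<close> would invert \<open>g\<close>. But
        \<open>x\<close> and \<open>t\<close> each invert \<open>g\<close>, so conjugation by their
        product fixes it, and \<open>inv g = g\<close> follows.\<close>
      have "x \<otimes> t \<in> ?H"
      proof (rule ccontr)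
        assume "x \<otimes> t \<notin> ?H"
        then have "inv g = x \<otimes> t \<otimes> g \<otimes> (x \<otimes> t)" "inv (x \<otimes> t) = x \<otimes> t"
          using conj sq x t inv_equality by simp_all
        then have "inv g = x \<otimes> t \<otimes> g \<otimes> (inv t \<otimes> inv x)"
          using x t by (simp add: inv_mult_group)
        moreover have inv: "inv t = t" "inv x = x"
          using sq x t False inv_equality by simp_all
        ultimately have "inv g = x \<otimes> t \<otimes> g \<otimes> (t \<otimes> x)"
          by simp
        also have "x \<otimes> t \<otimes> g \<otimes> (t \<otimes> x) = x \<otimes> (t \<otimes> g \<otimes> t) \<otimes> x"
          using x t gc by (simp add: m_assoc)
        also have "\<dots> = inv (x \<otimes> g \<otimes> x)"
          using x t gc conj[OF t] inv by (simp add: inv_mult_group m_assoc)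
        also have "\<dots> = g"
          using conj[OF x False] gc by simp
        finally show False
          using g by simp
      qed
      moreover have "x = x \<otimes> t \<otimes> t"
        using sq[OF t] x t by (simp add: m_assoc)
      ultimately show ?thesis by blast
    qed simp
    then have "carrier G \<subseteq> ?H \<union> (\<lambda>y. y \<otimes> t) ` ?H"
      by blast
    moreover have finH: "finite ?H"
      using fin H.subset finite_subset by blast
    ultimately have "order G \<le> card (?H \<union> (\<lambda>y. y \<otimes> t) ` ?H)"
      unfolding order_def by (intro card_mono) auto
    also have "\<dots> \<le> card ?H + card ?H"
      using card_Un_le[of ?H "(\<lambda>y. y \<otimes> t) ` ?H"] card_image_le[OF finH, of "\<lambda>y. y \<otimes> t"] by linarith
    finally have "order G \<le> 2 * ord g"
      using cardH by simp
    then show ?thesis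
      using iso_dihedral_groupI[OF fin gc t(1)] t sq conj by blast
  qed
qed

end

section \<open>Isomorphism invariance and the non-involutions of the four groups\<close>

lemma card_non_involutions_iso:
  assumes "group G" "group H" "G \<cong> H"
  shows "card (non_involutions G) = card (non_involutions H)"
proof -
  interpret G: group G by fact
  obtain h where "h \<in> iso G H"
    using assms(3) by (auto simp: is_iso_def)
  then interpret h: group_hom G H h
    using assms by (auto simp: group_hom_def group_hom_axioms_def iso_def)
  have bij: "bij_betw h (carrier G) (carrier H)"
    using \<open>h \<in> iso G H\<close> by (simp add: iso_def)
  \<comment> \<open>By injectivity \<open>h\<close> reflects the identity as well as preserving it,
    so squaring to the identity transfers both ways.\<close>
  have one: "h x = \<one>\<^bsub>H\<^esub> \<longleftrightarrow> x = \<one>\<^bsub>G\<^esub>" if "x \<in> carrier G" for x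
    using bij that by (metis G.one_closed bij_betw_def h.hom_one inj_onD)
  have N: "h x \<in> non_involutions H \<longleftrightarrow> x \<in> non_involutions G" if "x \<in> carrier G" for x
    using one[of "x \<otimes>\<^bsub>G\<^esub> x"] that by (simp add: non_involutions_def)
  have sub: "non_involutions G \<subseteq> carrier G" "non_involutions H \<subseteq> h ` carrier G"
    using bij by (auto simp: non_involutions_def bij_betw_def)
  have "h ` non_involutions G = non_involutions H"
    using N sub by blast
  moreover have "inj_on h (non_involutions G)"
    using bij sub(1) inj_on_subset unfolding bij_betw_def by blast
  ultimately show ?thesis
    using card_image by metis
qed

text \<open>Inversion acts on the non-involutions without fixed points, so two of them form an
  inverse pair. Unlike the pair, the cardinality transfers directly along isomorphisms.\<close>

lemma (in group) ex_non_involutions_iff: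
  "(\<exists>g. inv g \<noteq> g \<and> non_involutions G = {g, inv g}) \<longleftrightarrow> card (non_involutions G) = 2"
proof
  assume "card (non_involutions G) = 2"
  then obtain g k where gk: "non_involutions G = {g, k}" "g \<noteq> k"
    by (auto simp: card_2_iff)
  then have "inv g \<noteq> g" "inv g \<in> {g, k}"
    using inv_non_involutions[of g] non_involutions_iff[of g] by auto
  with gk show "\<exists>g. inv g \<noteq> g \<and> non_involutions G = {g, inv g}"
    by blast
qed auto

lemma non_involutions_integer_mod_group:
  "non_involutions (integer_mod_group 3) = {1, 2}"
  "non_involutions (integer_mod_group 4) = {1, 3}"
  unfolding non_involutions_def carrier_integer_mod_group by auto presburger+

text \<open>Every reflection squares to the identity, so only rotations contribute.\<close>

lemma non_involutions_dihedral_group: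
  "non_involutions (dihedral_group n) = non_involutions (integer_mod_group n) \<times> {False}"
  by (auto simp: non_involutions_def dihedral_group_def)

lemma sym_group_3_iso: "sym_group 3 \<cong> dihedral_group 3"
proof -
  \<comment> \<open>The composite is the 3-cycle taking 1 to 2, 2 to 3 and 3 to 1. It serves as the
    rotation and \<open>?t\<close> as the reflection.\<close>
  let ?g = "Transposition.transpose 1 2 \<circ> Transposition.transpose 2 3 :: nat \<Rightarrow> nat"
  let ?t = "Transposition.transpose 1 2 :: nat \<Rightarrow> nat"
  interpret S: group "sym_group 3" by (rule sym_group_is_group)
  note sym = sym_group_carrier sym_group_mult sym_group_one
  have card: "card (carrier (sym_group 3)) = 6"
    by (simp add: sym_group_card_carrier fact_numeral)
  \<comment> \<open>An infinite set has \<open>card\<close> 0, so the value 6 yields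
    finiteness.\<close>
  then have fin: "finite (carrier (sym_group 3))"
    using card_ge_0_finite by force
  have t: "?t \<in> carrier (sym_group 3)"
    unfolding sym by (intro permutes_swap_id) auto
  have g: "?g \<in> carrier (sym_group 3)"
    unfolding sym by (intro permutes_compose permutes_swap_id) auto
  have g3: "?g \<circ> ?g \<circ> ?g = id"
    by (auto simp: fun_eq_iff Transposition.transpose_def)
  have "S.ord ?g = 3"
    by (rule S.ord_eq_3[OF g]) (use g3 in \<open>auto simp: sym fun_eq_iff Transposition.transpose_def\<close>)
  moreover have "sym_group 3 \<cong> dihedral_group (S.ord ?g)"
  proof (rule S.iso_dihedral_groupI[OF fin g t])
    \<comment> \<open>A power of \<open>?g\<close> would commute with \<open>?g\<close>; the two
      products with \<open>?t\<close> differ at the point 1, with values 1 and 3.\<close>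
    show "?t \<noteq> ?g [^]\<^bsub>sym_group 3\<^esub> i" for i :: int
    proof
      assume "?t = ?g [^]\<^bsub>sym_group 3\<^esub> i"
      then have "?t \<otimes>\<^bsub>sym_group 3\<^esub> ?g = ?g \<otimes>\<^bsub>sym_group 3\<^esub> ?t"
        using g by (metis S.int_pow_1 S.int_pow_mult add.commute)
      then have "(?t \<circ> ?g) 1 = (?g \<circ> ?t) 1"
        by (simp add: sym)
      then show False
        by (simp add: Transposition.transpose_def)
    qed
    show "?t \<otimes>\<^bsub>sym_group 3\<^esub> ?t = \<one>\<^bsub>sym_group 3\<^esub>"
      by (simp add: sym)
    show "?t \<otimes>\<^bsub>sym_group 3\<^esub> ?g \<otimes>\<^bsub>sym_group 3\<^esub> ?t = inv\<^bsub>sym_group 3\<^esub> ?g"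
    proof (rule S.inv_equality[symmetric])
      show "?t \<otimes>\<^bsub>sym_group 3\<^esub> ?g \<otimes>\<^bsub>sym_group 3\<^esub> ?t \<otimes>\<^bsub>sym_group 3\<^esub> ?g = \<one>\<^bsub>sym_group 3\<^esub>"
        by (auto simp: sym fun_eq_iff Transposition.transpose_def)
      show "?t \<otimes>\<^bsub>sym_group 3\<^esub> ?g \<otimes>\<^bsub>sym_group 3\<^esub> ?t \<in> carrier (sym_group 3)"
        using g t by blast
    qed (rule g)
    show "order (sym_group 3) \<le> 2 * S.ord ?g"
      using card \<open>S.ord ?g = 3\<close> by (simp add: order_def)
  qed
  ultimately show ?thesis by simp
qed

theorem theorem2:
  fixes G :: "('a, 'b) monoid_scheme"
  assumes "group G" and "finite (carrier G)"
  shows "card (cyclic_subgroups G) = order G - 1 \<longleftrightarrow>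
    G \<cong> integer_mod_group 3 \<or> G \<cong> integer_mod_group 4 \<or>
    G \<cong> sym_group 3 \<or> G \<cong> dihedral_group 4"
proof -
  interpret group G by fact
  have "card (cyclic_subgroups G) = order G - 1 \<longleftrightarrow>
      (\<exists>g. inv\<^bsub>G\<^esub> g \<noteq> g \<and> non_involutions G = {g, inv\<^bsub>G\<^esub> g})"
    using assms card_cyclic_subgroups_iff by blast
  also have "\<dots> \<longleftrightarrow> G \<cong> integer_mod_group 3 \<or> G \<cong> integer_mod_group 4 \<or>
      G \<cong> dihedral_group 3 \<or> G \<cong> dihedral_group 4"
  proof
    assume "\<exists>g. inv\<^bsub>G\<^esub> g \<noteq> g \<and> non_involutions G = {g, inv\<^bsub>G\<^esub> g}"
    then show "G \<cong> integer_mod_group 3 \<or> G \<cong> integer_mod_group 4 \<or>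
        G \<cong> dihedral_group 3 \<or> G \<cong> dihedral_group 4"
      using iso_of_non_involutions[OF assms(2)] by (metis insertE singletonD)
  next
    assume "G \<cong> integer_mod_group 3 \<or> G \<cong> integer_mod_group 4 \<or>
        G \<cong> dihedral_group 3 \<or> G \<cong> dihedral_group 4"
    \<comment> \<open>For the converse it suffices to count in the four model groups, as the count
      is an isomorphism invariant.\<close>
    moreover have "card (non_involutions (integer_mod_group 3)) = 2"
        "card (non_involutions (integer_mod_group 4)) = 2"
        "card (non_involutions (dihedral_group 3)) = 2"
        "card (non_involutions (dihedral_group 4)) = 2"
      by (simp_all add: non_involutions_dihedral_group non_involutions_integer_mod_group
          card_cartesian_product)
    ultimately have "card (non_involutions G) = 2"
      using card_non_involutions_iso[OF assms(1)] group_integer_mod_group group_dihedral_group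
      by metis
    then show "\<exists>g. inv\<^bsub>G\<^esub> g \<noteq> g \<and> non_involutions G = {g, inv\<^bsub>G\<^esub> g}"
      by (rule ex_non_involutions_iff[THEN iffD2])
  qed
  also have "G \<cong> dihedral_group 3 \<longleftrightarrow> G \<cong> sym_group 3"
    using iso_trans[OF _ sym_group_3_iso, of G]
      iso_trans[OF _ group.iso_sym[OF sym_group_is_group sym_group_3_iso], of G] by blast
  finally show ?thesis .
qed

end
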